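(* Let $X$ be a vector lattice with the $\sigma$-projection property. Let $\overline{X}^{1}$ and $\overline{X}$ be the uniform adherence and the uniform closure of $X$ in its order completion $X^\delta$, respectively. Then $\overline{X}^{1}=\overline{X}$. Moreover, this set is the least countably order complete sublattice of $X^\delta$ containing $X$.
   Context: All vector lattices are real and Archimedean. $X$ has the $\sigma$-projection property if every band of $X$ generated by a countable set is a projection band. A vector lattice is countably order complete if every countable (non-empty) set which is bounded above has a supremum (for a sublattice, this is understood in the sublattice as a vector lattice in its own right). In a vector lattice $V$, a net $(x_\alpha)$ converges (relatively) uniformly to $x\in V$ if there is $e\in V_+$ such that for every $\varepsilon>0$ there is $\alpha_0$ with $|x_\alpha-x|\le\varepsilon e$ for all $\alpha\ge\alpha_0$. The uniform adherence of a subset $A$ of $V$ in $V$ is the set of all limits in $V$ of nets in $A$ converging uniformly in $V$; $A$ is uniformly closed in $V$ if it equals its uniform adherence; the uniform closure of $A$ in $V$ is the intersection of all uniformly closed subsets of $V$ containing $A$. $X^\delta$ denotes the order (Dedekind) completion of $X$. *)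

theory Defs
  imports Complex_Main "HOL-Library.Lattice_Algebras" "HOL-Library.Lub_Glb"
    "HOL-Library.Countable_Set"
begin

section \<open>Archimedean vector lattices\<close>

class archimedean_vector_lattice = ordered_real_vector + lattice_ab_group_add_abs +
  assumes archimedean: "(\<And>n::nat. real n *\<^sub>R x \<le> y) \<Longrightarrow> x \<le> 0"

definition vector_sublattice :: "'a::archimedean_vector_lattice set \<Rightarrow> bool" where
  "vector_sublattice Y \<longleftrightarrow>
     subspace Y \<and> (\<forall>x\<in>Y. \<forall>y\<in>Y. sup x y \<in> Y \<and> inf x y \<in> Y)"

text \<open>Upper bounds and suprema are taken in \<open>Y\<close>, not in the ambient lattice: in \<open>isUb Y\<close>
  and \<open>isLub Y\<close> the first argument is the set from which the (least) upper bound is taken.\<close>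

definition countably_order_complete :: "'a::archimedean_vector_lattice set \<Rightarrow> bool" where
  "countably_order_complete Y \<longleftrightarrow>
     (\<forall>S. S \<subseteq> Y \<and> countable S \<and> S \<noteq> {} \<and> (\<exists>u. isUb Y S u) \<longrightarrow> (\<exists>s. isLub Y S s))"


section \<open>Bands and the sigma-projection property\<close>

definition order_ideal :: "'a::archimedean_vector_lattice set \<Rightarrow> bool" where
  "order_ideal B \<longleftrightarrow> subspace B \<and> (\<forall>x. \<forall>y\<in>B. \<bar>x\<bar> \<le> \<bar>y\<bar> \<longrightarrow> x \<in> B)"

definition band :: "'a::archimedean_vector_lattice set \<Rightarrow> bool" where
  "band B \<longleftrightarrow>
     order_ideal B \<and> (\<forall>D s. D \<subseteq> B \<and> D \<noteq> {} \<and> isLub UNIV D s \<longrightarrow> s \<in> B)"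

definition disjoint_complement ::
    "'a::archimedean_vector_lattice set \<Rightarrow> 'a set" where
  "disjoint_complement B = {x. \<forall>b\<in>B. inf \<bar>x\<bar> \<bar>b\<bar> = 0}"

text \<open>The sum of \<open>B\<close> and its disjoint complement is automatically direct.\<close>

definition projection_band :: "'a::archimedean_vector_lattice set \<Rightarrow> bool" where
  "projection_band B \<longleftrightarrow>
     band B \<and> (\<forall>x. \<exists>b\<in>B. \<exists>c\<in>disjoint_complement B. x = b + c)"

definition sigma_projection_property ::
    "'a::archimedean_vector_lattice itself \<Rightarrow> bool" where
  "sigma_projection_property _ \<longleftrightarrow>
     (\<forall>C::'a set. countable C \<longrightarrow> projection_band (band hull C))"


section \<open>Order completion\<close>

text \<open>The type \<open>'b\<close> together with the embedding \<open>\<iota>\<close> is an order (Dedekind) completion of \<open>'a\<close>: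
  \<open>'b\<close> is Dedekind complete (class \<open>conditionally_complete_lattice\<close>) and \<open>\<iota>\<close> is a vector lattice
  isomorphism onto an order dense and majorizing vector sublattice of \<open>'b\<close>. The order completion
  is determined by this up to a unique isomorphism extending the embeddings.\<close>

definition is_order_completion ::
    "('a::archimedean_vector_lattice \<Rightarrow>
      'b::{archimedean_vector_lattice, conditionally_complete_lattice}) \<Rightarrow> bool" where
  "is_order_completion \<iota> \<longleftrightarrow>
     linear \<iota> \<and> inj \<iota> \<and>
     (\<forall>x y. \<iota> (sup x y) = sup (\<iota> x) (\<iota> y)) \<and>
     (\<forall>x y. \<iota> (inf x y) = inf (\<iota> x) (\<iota> y)) \<and>
     (\<forall>y>0. \<exists>x. 0 < \<iota> x \<and> \<iota> x \<le> y) \<and>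
     (\<forall>y. \<exists>x. y \<le> \<iota> x)"


section \<open>Relatively uniform convergence\<close>

definition directed_set :: "'i set \<Rightarrow> ('i \<Rightarrow> 'i \<Rightarrow> bool) \<Rightarrow> bool" where
  "directed_set I le \<longleftrightarrow>
     I \<noteq> {} \<and> reflp_on I le \<and> transp_on I le \<and>
     (\<forall>a\<in>I. \<forall>b\<in>I. \<exists>c\<in>I. le a c \<and> le b c)"

definition uniformly_converges ::
    "'i set \<Rightarrow> ('i \<Rightarrow> 'i \<Rightarrow> bool) \<Rightarrow> ('i \<Rightarrow> 'a::archimedean_vector_lattice) \<Rightarrow> 'a \<Rightarrow> bool" where
  "uniformly_converges I le x l \<longleftrightarrow>
     (\<exists>e\<ge>0. \<forall>\<epsilon>::real>0. \<exists>a0\<in>I. \<forall>a\<in>I. le a0 a \<longrightarrow> \<bar>x a - l\<bar> \<le> \<epsilon> *\<^sub>R e)"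

text \<open>HOL cannot quantify over the type of the index set inside a formula. The type
  \<open>'a \<times> 'a set\<close> (points paired with tails of a net) is large enough for every net with values
  in \<open>'a\<close>; this is the content of \<open>mem_uniform_adherenceI\<close> below.\<close>

definition uniform_adherence ::
    "'a::archimedean_vector_lattice set \<Rightarrow> 'a set" where
  "uniform_adherence A =
     {l. \<exists>(I :: ('a \<times> 'a set) set) le x.
           directed_set I le \<and> (\<forall>a\<in>I. x a \<in> A) \<and> uniformly_converges I le x l}"

lemma mem_uniform_adherenceI:
  fixes I :: "'i set" and x :: "'i \<Rightarrow> 'a::archimedean_vector_lattice"
  assumes dir: "directed_set I le" and mem: "\<forall>a\<in>I. x a \<in> A"
    and conv: "uniformly_converges I le x l"
  shows "l \<in> uniform_adherence A"
proof -
  define tail where "tail a = x ` {b\<in>I. le a b}" for a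
  define J where "J = {(x b, tail a) | a b. a \<in> I \<and> b \<in> I \<and> le a b}"
  define le' where "le' p q \<longleftrightarrow> snd q \<subseteq> snd p" for p q :: "'a \<times> 'a set"
  have refl: "le a a" if "a \<in> I" for a
    using dir that by (auto simp: directed_set_def reflp_on_def)
  have trans: "le a c" if "le a b" "le b c" "a \<in> I" "b \<in> I" "c \<in> I" for a b c
    using dir that unfolding directed_set_def transp_on_def by blast
  have inJ: "(x a, tail a) \<in> J" if "a \<in> I" for a
    using refl that by (auto simp: J_def)
  have "directed_set J le'"
    unfolding directed_set_def
  proof (intro conjI ballI)
    show "J \<noteq> {}" using inJ dir by (auto simp: directed_set_def)
    show "reflp_on J le'" by (auto simp: reflp_on_def le'_def)
    show "transp_on J le'" by (auto simp: transp_on_def le'_def)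
    fix p q assume "p \<in> J" "q \<in> J"
    then obtain a b where ab: "a \<in> I" "b \<in> I" "snd p = tail a" "snd q = tail b"
      unfolding J_def by fastforce
    obtain c where c: "c \<in> I" "le a c" "le b c"
      using dir ab(1,2) unfolding directed_set_def by blast
    have "tail c \<subseteq> tail a" "tail c \<subseteq> tail b"
      unfolding tail_def using ab(1,2) c trans by blast+
    then have "le' p (x c, tail c) \<and> le' q (x c, tail c)"
      by (simp add: le'_def ab(3,4))
    then show "\<exists>r\<in>J. le' p r \<and> le' q r"
      using inJ[OF c(1)] by blast
  qed
  moreover have "\<forall>p\<in>J. fst p \<in> A" using mem by (auto simp: J_def)
  moreover have "uniformly_converges J le' fst l"
  proof -
    obtain e where e: "e \<ge> 0"
      "\<And>\<epsilon>::real. \<epsilon> > 0 \<Longrightarrow> \<exists>a0\<in>I. \<forall>a\<in>I. le a0 a \<longrightarrow> \<bar>x a - l\<bar> \<le> \<epsilon> *\<^sub>R e"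
      using conv by (auto simp: uniformly_converges_def)
    have "\<exists>p0\<in>J. \<forall>p\<in>J. le' p0 p \<longrightarrow> \<bar>fst p - l\<bar> \<le> \<epsilon> *\<^sub>R e" if "\<epsilon> > 0" for \<epsilon> :: real
    proof -
      obtain a0 where a0: "a0 \<in> I" "\<And>a. a \<in> I \<Longrightarrow> le a0 a \<Longrightarrow> \<bar>x a - l\<bar> \<le> \<epsilon> *\<^sub>R e"
        using e(2)[OF \<open>\<epsilon> > 0\<close>] by blast
      have "\<bar>fst p - l\<bar> \<le> \<epsilon> *\<^sub>R e" if p: "p \<in> J" "le' (x a0, tail a0) p" for p
      proof -
        have "fst p \<in> snd p" using p(1) by (auto simp: J_def tail_def)
        then have "fst p \<in> tail a0" using p(2) by (auto simp: le'_def)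
        then show ?thesis using a0(2) by (auto simp: tail_def)
      qed
      then show ?thesis using inJ[OF a0(1)] by blast
    qed
    then show ?thesis using e(1) by (auto simp: uniformly_converges_def)
  qed
  ultimately show ?thesis unfolding uniform_adherence_def by blast
qed

definition uniformly_closed :: "'a::archimedean_vector_lattice set \<Rightarrow> bool" where
  "uniformly_closed A \<longleftrightarrow> uniform_adherence A = A"

definition uniform_closure ::
    "'a::archimedean_vector_lattice set \<Rightarrow> 'a set" where
  "uniform_closure A = uniformly_closed hull A"

end

theory Submission
  imports Defs
begin

text \<open>Both the uniform adherence and the uniform closure of \<open>X\<close> coincide with the set \<open>G\<close> of all
  suprema in \<open>X\<^sup>\<delta>\<close> of countable subsets of \<open>X\<close>, which is visibly stable under countable suprema.
  A limit with regulator \<open>e \<in> X\<close> of elements \<open>z\<^sub>n\<close> of \<open>G\<close> is the supremum of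
  the elements \<open>z\<^sub>n - e/n\<close> of \<open>G\<close>.
  Conversely, let \<open>y = sup C\<close> with \<open>C \<subseteq> X\<close> countable and \<open>\<bar>y\<bar> \<le> v \<in> X\<close>, and let \<open>p\<close> be the projection
  of \<open>v\<close> onto the band of \<open>X\<close> generated by the positive parts of the elements of \<open>C\<close>. Then
  \<open>p - v \<le> y \<le> p\<close>, so \<open>x = p - v/2\<close> satisfies \<open>\<bar>y - x\<bar> \<le> v/2\<close>. Since \<open>y - x\<close> is again in \<open>G\<close>, this
  can be iterated, and \<open>y\<close> is a uniform limit of elements of \<open>X\<close> with regulator \<open>v\<close>.\<close>

declare neg_inf_eq_sup [simp del] neg_sup_eq_inf [simp del]
  diff_inf_eq_sup [simp del] diff_sup_eq_inf [simp del]

section \<open>Suprema, absolute values and the Archimedean property\<close>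

lemma isLub_iff:
  "isLub Y S s \<longleftrightarrow> s \<in> Y \<and> (\<forall>x\<in>S. x \<le> s) \<and> (\<forall>u\<in>Y. (\<forall>x\<in>S. x \<le> u) \<longrightarrow> s \<le> u)"
  by (auto simp: isLub_def leastP_def isUb_def setle_def setge_def)

lemma isLub_UNION:
  fixes y :: "'a::order"
  assumes "isLub UNIV S y" and "\<And>s. s \<in> S \<Longrightarrow> isLub UNIV (C s) s"
  shows "isLub UNIV (\<Union>s\<in>S. C s) y"
proof -
  have "x \<le> y" if "s \<in> S" "x \<in> C s" for s x
    using assms(1) assms(2)[OF that(1)] that order_trans[of x s y] by (simp add: isLub_iff)
  moreover have "y \<le> u" if "\<And>s x. s \<in> S \<Longrightarrow> x \<in> C s \<Longrightarrow> x \<le> u" for u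
    using assms that unfolding isLub_iff by simp
  ultimately show ?thesis by (auto simp: isLub_iff)
qed

lemma isLub_translate:
  fixes y :: "'a::ordered_ab_group_add"
  assumes "isLub UNIV C y"
  shows "isLub UNIV ((\<lambda>c. c - a) ` C) (y - a)"
  using assms unfolding isLub_iff by (auto simp: diff_le_eq)

text \<open>Taking \<epsilon> = 1/n and multiplying by n gives n x \<le> e, the form in which the
  Archimedean axiom is stated.\<close>

lemma le_zero_if_le_scaleR:
  fixes x e :: "'a::archimedean_vector_lattice"
  assumes "e \<ge> 0" and "\<And>\<epsilon>::real. \<epsilon> > 0 \<Longrightarrow> x \<le> \<epsilon> *\<^sub>R e"
  shows "x \<le> 0"
proof (rule archimedean)
  fix n :: nat
  show "real n *\<^sub>R x \<le> e"
  proof (cases "n = 0")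
    case False
    then have "real n *\<^sub>R x \<le> real n *\<^sub>R ((1 / real n) *\<^sub>R e)"
      by (intro scaleR_left_mono assms(2)) auto
    then show ?thesis using False by simp
  qed (use assms(1) in simp)
qed

lemma abs_scaleR_le:
  fixes x :: "'a::archimedean_vector_lattice"
  shows "\<bar>r *\<^sub>R x\<bar> \<le> \<bar>r\<bar> *\<^sub>R \<bar>x\<bar>"
proof -
  have *: "r *\<^sub>R x \<le> \<bar>r\<bar> *\<^sub>R \<bar>x\<bar>" for r
  proof (cases "r \<ge> 0")
    case True
    then show ?thesis by (simp add: scaleR_left_mono abs_ge_self)
  next
    case False
    then have "(- r) *\<^sub>R (- x) \<le> (- r) *\<^sub>R \<bar>x\<bar>"
      by (intro scaleR_left_mono) (auto simp: abs_ge_minus_self)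
    then show ?thesis using False by simp
  qed
  show ?thesis using *[of r] *[of "- r"] by (intro abs_leI) auto
qed

text \<open>This Lipschitz estimate lets suprema pass to uniform limits. The right-hand side is
  symmetric in the two pairs, so a one-sided bound suffices.\<close>

lemma abs_sup_diff_le:
  fixes a b c d :: "'a::archimedean_vector_lattice"
  shows "\<bar>sup a b - sup c d\<bar> \<le> \<bar>a - c\<bar> + \<bar>b - d\<bar>"
proof -
  have *: "sup a b - sup c d \<le> \<bar>a - c\<bar> + \<bar>b - d\<bar>" for a b c d :: 'a
  proof -
    have "a \<le> sup c d + (\<bar>a - c\<bar> + \<bar>b - d\<bar>)"
      using add_mono[OF sup_ge1[of c d] add_increasing2[OF abs_ge_zero[of "b - d"] abs_ge_self[of "a - c"]]]
      by simp
    moreover have "b \<le> sup c d + (\<bar>a - c\<bar> + \<bar>b - d\<bar>)"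
      using add_mono[OF sup_ge2[of d c] add_increasing[OF abs_ge_zero[of "a - c"] abs_ge_self[of "b - d"]]]
      by simp
    ultimately show ?thesis by (simp add: diff_le_eq add.commute)
  qed
  show ?thesis
    using *[of a b c d] *[of c d a b] by (intro abs_leI) (simp_all add: abs_minus_commute)
qed

text \<open>The positive part is the negative part plus \<open>s\<close>, so the infimum is the
  negative part plus \<open>inf s 0\<close>, and these two cancel.\<close>

lemma inf_pos_neg_part:
  fixes s :: "'a::archimedean_vector_lattice"
  shows "inf (sup s 0) (sup (- s) 0) = 0"
proof -
  let ?n = "sup (- s) 0"
  have "sup s 0 = ?n + s"
    by (simp add: add_sup_distrib_right sup.commute)
  then have "inf (sup s 0) ?n = ?n + inf s 0"
    by (simp add: add_inf_distrib_left)
  then show ?thesis by (simp add: inf_eq_neg_sup[of s 0])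
qed

lemma abs_inf_diff_le:
  fixes a b c d :: "'a::archimedean_vector_lattice"
  shows "\<bar>inf a b - inf c d\<bar> \<le> \<bar>a - c\<bar> + \<bar>b - d\<bar>"
  using abs_sup_diff_le[of "- c" "- d" "- a" "- b"]
  unfolding inf_eq_neg_sup[of a b] inf_eq_neg_sup[of c d]
  by simp


subsection \<open>Uniform adherence\<close>

text \<open>One regulator serves every \<epsilon>, so approximants chosen for \<epsilon> = 1/(n+1)
  already form a uniformly convergent sequence. From here on nets are no longer handled.\<close>

lemma mem_uniform_adherence_iff:
  "l \<in> uniform_adherence A \<longleftrightarrow>
     (\<exists>e\<ge>0. \<forall>\<epsilon>::real>0. \<exists>x\<in>A. \<bar>x - l\<bar> \<le> \<epsilon> *\<^sub>R e)" (is "_ \<longleftrightarrow> ?R")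
proof
  assume "l \<in> uniform_adherence A"
  then obtain I :: "('a \<times> 'a set) set" and le x where
    d: "directed_set I le" and x: "\<forall>a\<in>I. x a \<in> A" and c: "uniformly_converges I le x l"
    unfolding uniform_adherence_def by blast
  from c obtain e where e: "e \<ge> 0"
    "\<And>\<epsilon>::real. \<epsilon> > 0 \<Longrightarrow> \<exists>a0\<in>I. \<forall>a\<in>I. le a0 a \<longrightarrow> \<bar>x a - l\<bar> \<le> \<epsilon> *\<^sub>R e"
    unfolding uniformly_converges_def by blast
  have "\<exists>x\<in>A. \<bar>x - l\<bar> \<le> \<epsilon> *\<^sub>R e" if "\<epsilon> > 0" for \<epsilon> :: real
    using e(2)[OF that] d x by (fastforce simp: directed_set_def reflp_on_def)
  then show ?R using e(1) by blast
next
  assume ?R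
  then obtain e where e: "e \<ge> 0" "\<And>\<epsilon>::real. \<epsilon> > 0 \<Longrightarrow> \<exists>x\<in>A. \<bar>x - l\<bar> \<le> \<epsilon> *\<^sub>R e"
    by blast
  have "\<exists>x\<in>A. \<bar>x - l\<bar> \<le> (1 / real (Suc n)) *\<^sub>R e" for n
    by (intro e(2)) simp
  then obtain x where x: "\<And>n. x n \<in> A" "\<And>n. \<bar>x n - l\<bar> \<le> (1 / real (Suc n)) *\<^sub>R e"
    by metis
  show "l \<in> uniform_adherence A"
  proof (rule mem_uniform_adherenceI)
    show "directed_set (UNIV :: nat set) (\<le>)"
      by (auto simp: directed_set_def reflp_on_def transp_on_def intro: max.cobounded1 max.cobounded2)
    show "\<forall>n\<in>UNIV. x n \<in> A" using x(1) by blast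
    have "\<exists>m. \<forall>n\<ge>m. \<bar>x n - l\<bar> \<le> \<epsilon> *\<^sub>R e" if \<epsilon>: "\<epsilon> > 0" for \<epsilon> :: real
    proof -
      obtain m where m: "1 / real (Suc m) < \<epsilon>"
        using nat_approx_posE[OF \<epsilon>] by blast
      have "\<bar>x n - l\<bar> \<le> \<epsilon> *\<^sub>R e" if "n \<ge> m" for n
      proof -
        have "1 / real (Suc n) \<le> 1 / real (Suc m)" using that by (simp add: frac_le)
        then have "1 / real (Suc n) \<le> \<epsilon>" using m by linarith
        then show ?thesis
          using x(2)[of n] scaleR_right_mono[OF _ e(1)] order_trans by blast
      qed
      then show ?thesis by blast
    qed
    then show "uniformly_converges UNIV (\<le>) x l"
      unfolding uniformly_converges_def using e(1) by auto
  qed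
qed

lemma subset_uniform_adherence: "A \<subseteq> uniform_adherence A"
proof
  fix x assume "x \<in> A"
  then show "x \<in> uniform_adherence A"
    unfolding mem_uniform_adherence_iff by (intro exI[of _ 0]) auto
qed

lemma uniform_adherence_mono: "A \<subseteq> B \<Longrightarrow> uniform_adherence A \<subseteq> uniform_adherence B"
  by (fastforce simp: mem_uniform_adherence_iff)

text \<open>Idempotence at \<open>A\<close> makes the adherence closed, and monotonicity puts it
  inside every closed superset of \<open>A\<close>.\<close>

lemma uniform_closure_eq_adherence:
  assumes "uniform_adherence (uniform_adherence A) \<subseteq> uniform_adherence A"
  shows "uniform_closure A = uniform_adherence A"
  unfolding uniform_closure_def
proof (rule hull_unique)
  show "A \<subseteq> uniform_adherence A" by (rule subset_uniform_adherence)
  show "uniformly_closed (uniform_adherence A)"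
    unfolding uniformly_closed_def using assms subset_uniform_adherence by blast
  show "uniform_adherence A \<subseteq> T" if "A \<subseteq> T" "uniformly_closed T" for T
    using uniform_adherence_mono[OF that(1)] that(2) by (simp add: uniformly_closed_def)
qed

lemma vector_sublattice_uniform_adherence:
  assumes A: "vector_sublattice A"
  shows "vector_sublattice (uniform_adherence A)"
proof -
  have sub: "subspace A" using A by (simp add: vector_sublattice_def)
  \<comment> \<open>Addition, \<open>sup\<close> and \<open>inf\<close> satisfy the same Lipschitz
    bound; the regulators of the two arguments are added.\<close>
  have binary: "f x y \<in> uniform_adherence A"
    if x: "x \<in> uniform_adherence A" and y: "y \<in> uniform_adherence A"
      and f: "\<And>a b. a \<in> A \<Longrightarrow> b \<in> A \<Longrightarrow> f a b \<in> A"
      and lip: "\<And>a b c d. \<bar>f a b - f c d\<bar> \<le> \<bar>a - c\<bar> + \<bar>b - d\<bar>" for f x y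
  proof -
    obtain e1 where e1: "e1 \<ge> 0" "\<And>\<epsilon>::real. \<epsilon> > 0 \<Longrightarrow> \<exists>a\<in>A. \<bar>a - x\<bar> \<le> \<epsilon> *\<^sub>R e1"
      using x unfolding mem_uniform_adherence_iff by blast
    obtain e2 where e2: "e2 \<ge> 0" "\<And>\<epsilon>::real. \<epsilon> > 0 \<Longrightarrow> \<exists>a\<in>A. \<bar>a - y\<bar> \<le> \<epsilon> *\<^sub>R e2"
      using y unfolding mem_uniform_adherence_iff by blast
    have "\<exists>a\<in>A. \<bar>a - f x y\<bar> \<le> \<epsilon> *\<^sub>R (e1 + e2)" if \<epsilon>: "\<epsilon> > 0" for \<epsilon> :: real
    proof -
      obtain a b where ab: "a \<in> A" "\<bar>a - x\<bar> \<le> \<epsilon> *\<^sub>R e1" "b \<in> A" "\<bar>b - y\<bar> \<le> \<epsilon> *\<^sub>R e2"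
        using e1(2)[OF \<epsilon>] e2(2)[OF \<epsilon>] by blast
      have "\<bar>f a b - f x y\<bar> \<le> \<epsilon> *\<^sub>R (e1 + e2)"
        using order_trans[OF lip add_mono[OF ab(2,4)]] by (simp add: scaleR_add_right)
      then show ?thesis using f ab by blast
    qed
    then show ?thesis
      unfolding mem_uniform_adherence_iff using e1(1) e2(1) by (intro exI[of _ "e1 + e2"]) simp
  qed
  have scale: "r *\<^sub>R x \<in> uniform_adherence A" if x: "x \<in> uniform_adherence A" for r x
  proof -
    obtain e where e: "e \<ge> 0" "\<And>\<epsilon>::real. \<epsilon> > 0 \<Longrightarrow> \<exists>a\<in>A. \<bar>a - x\<bar> \<le> \<epsilon> *\<^sub>R e"
      using x unfolding mem_uniform_adherence_iff by blast
    \<comment> \<open>Scaling the regulator instead of dividing \<epsilon> by |r| avoids a separate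
      case r = 0.\<close>
    have "\<exists>a\<in>A. \<bar>a - r *\<^sub>R x\<bar> \<le> \<epsilon> *\<^sub>R (\<bar>r\<bar> *\<^sub>R e)" if \<epsilon>: "\<epsilon> > 0" for \<epsilon> :: real
    proof -
      obtain a where a: "a \<in> A" "\<bar>a - x\<bar> \<le> \<epsilon> *\<^sub>R e" using e(2)[OF \<epsilon>] by blast
      have "\<bar>r *\<^sub>R a - r *\<^sub>R x\<bar> \<le> \<bar>r\<bar> *\<^sub>R \<bar>a - x\<bar>"
        using abs_scaleR_le[of r "a - x"] by (simp add: scaleR_diff_right)
      also have "\<dots> \<le> \<bar>r\<bar> *\<^sub>R (\<epsilon> *\<^sub>R e)" using a(2) by (intro scaleR_left_mono) auto
      finally show ?thesis
        using a(1) sub by (intro bexI[of _ "r *\<^sub>R a"]) (auto simp: mult.commute subspace_scale)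
    qed
    then show ?thesis
      unfolding mem_uniform_adherence_iff using e(1)
      by (intro exI[of _ "\<bar>r\<bar> *\<^sub>R e"]) (simp add: scaleR_nonneg_nonneg)
  qed
  have "x + y \<in> uniform_adherence A"
    if "x \<in> uniform_adherence A" "y \<in> uniform_adherence A" for x y
  proof (rule binary[OF that])
    show "\<bar>(a + b) - (c + d)\<bar> \<le> \<bar>a - c\<bar> + \<bar>b - d\<bar>" for a b c d :: 'a
      using abs_triangle_ineq[of "a - c" "b - d"] by (simp add: algebra_simps)
  qed (simp add: sub subspace_add)
  moreover have "sup x y \<in> uniform_adherence A"
    if "x \<in> uniform_adherence A" "y \<in> uniform_adherence A" for x y
    by (rule binary[OF that])
      (use A in \<open>auto simp: abs_sup_diff_le vector_sublattice_def\<close>)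
  moreover have "inf x y \<in> uniform_adherence A"
    if "x \<in> uniform_adherence A" "y \<in> uniform_adherence A" for x y
    by (rule binary[OF that])
      (use A in \<open>auto simp: abs_inf_diff_le vector_sublattice_def\<close>)
  moreover have "0 \<in> uniform_adherence A"
    using subset_uniform_adherence sub subspace_0 by blast
  ultimately show ?thesis
    unfolding vector_sublattice_def subspace_def by (intro conjI allI ballI scale) simp_all
qed


subsection \<open>Disjointness\<close>

lemma disjoint_mono:
  fixes x y z :: "'a::archimedean_vector_lattice"
  assumes "inf y x = 0" and "0 \<le> z" and "z \<le> y"
  shows "inf z x = 0"
proof -
  have "0 \<le> x" using assms(1) inf_le2[of y x] by simp
  then show ?thesis using assms inf_mono[of z y x x] by (intro antisym) auto
qed

lemma order_ideal_disjoint: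
  fixes x :: "'a::archimedean_vector_lattice"
  assumes "0 \<le> x"
  shows "order_ideal {w. inf \<bar>w\<bar> x = 0}"
  unfolding order_ideal_def subspace_def
proof (intro conjI ballI allI impI)
  show "0 \<in> {w. inf \<bar>w\<bar> x = 0}" using assms by (simp add: inf_absorb1)
next
  fix a b assume ab: "a \<in> {w. inf \<bar>w\<bar> x = 0}" "b \<in> {w. inf \<bar>w\<bar> x = 0}"
  \<comment> \<open>The element z - |a| lies below both |b| and x, hence below 0; so z lies below
    both |a| and x, hence below 0 as well.\<close>
  define z where "z = inf \<bar>a + b\<bar> x"
  have zx: "z \<le> x" by (simp add: z_def)
  have "z \<le> \<bar>a\<bar> + \<bar>b\<bar>" unfolding z_def using abs_triangle_ineq le_infI1 by blast
  then have "z - \<bar>a\<bar> \<le> \<bar>b\<bar>" by (simp add: diff_le_eq add.commute)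
  moreover have "z - \<bar>a\<bar> \<le> x" using zx by (simp add: diff_le_eq add_increasing2)
  ultimately have "z - \<bar>a\<bar> \<le> inf \<bar>b\<bar> x" by simp
  also have "\<dots> = 0" using ab(2) by simp
  finally have "z \<le> inf \<bar>a\<bar> x" using zx by simp
  also have "\<dots> = 0" using ab(1) by simp
  finally show "a + b \<in> {w. inf \<bar>w\<bar> x = 0}" using assms by (simp add: antisym z_def)
next
  fix r a assume a: "a \<in> {w. inf \<bar>w\<bar> x = 0}"
  \<comment> \<open>The bound m \<ge> |r| gives z/m \<le> |a|, and m \<ge> 1 keeps z/m below
    x.\<close>
  define z m where "z = inf \<bar>r *\<^sub>R a\<bar> x" and "m = max 1 \<bar>r\<bar>"
  have m: "m \<ge> 1" by (simp add: m_def)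
  have z: "0 \<le> z" "z \<le> x" using assms by (simp_all add: z_def)
  have "z \<le> \<bar>r\<bar> *\<^sub>R \<bar>a\<bar>" unfolding z_def using abs_scaleR_le le_infI1 by blast
  also have "\<dots> \<le> m *\<^sub>R \<bar>a\<bar>" by (intro scaleR_right_mono) (auto simp: m_def)
  finally have "(1 / m) *\<^sub>R z \<le> (1 / m) *\<^sub>R (m *\<^sub>R \<bar>a\<bar>)"
    using m by (intro scaleR_left_mono) auto
  then have 1: "(1 / m) *\<^sub>R z \<le> \<bar>a\<bar>" using m by simp
  have "(1 / m) *\<^sub>R z \<le> 1 *\<^sub>R z" using z m by (intro scaleR_right_mono) auto
  then have "(1 / m) *\<^sub>R z \<le> x" using order_trans[OF _ z(2)] by simp
  then have "(1 / m) *\<^sub>R z \<le> inf \<bar>a\<bar> x" using 1 by simp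
  also have "\<dots> = 0" using a by simp
  finally have "m *\<^sub>R ((1 / m) *\<^sub>R z) \<le> m *\<^sub>R 0"
    using m by (intro scaleR_left_mono) auto
  then have "z \<le> 0" using m by simp
  then show "r *\<^sub>R a \<in> {w. inf \<bar>w\<bar> x = 0}" using z(1) by (simp add: antisym z_def)
next
  fix a b assume "b \<in> {w. inf \<bar>w\<bar> x = 0}" "\<bar>a\<bar> \<le> \<bar>b\<bar>"
  then show "a \<in> {w. inf \<bar>w\<bar> x = 0}" using disjoint_mono[of "\<bar>b\<bar>" x "\<bar>a\<bar>"] by simp
qed

text \<open>Supplies the bands that are compared with \<open>band hull P\<close> in
  \<open>halving\<close>. The positive and negative parts of a supremum \<open>s\<close> are shown
  to be disjoint from \<open>x\<close> separately.\<close>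

lemma band_disjoint:
  fixes x :: "'a::archimedean_vector_lattice"
  assumes x: "0 \<le> x"
  shows "band {w. inf \<bar>w\<bar> x = 0}" (is "band ?B")
  unfolding band_def
proof (intro conjI allI impI)
  show ideal: "order_ideal ?B" by (rule order_ideal_disjoint[OF x])
  fix D s assume Ds: "D \<subseteq> ?B \<and> D \<noteq> {} \<and> isLub UNIV D s"
  then obtain d0 where d0: "d0 \<in> D" by blast
  have ub: "d \<le> s" if "d \<in> D" for d using Ds that by (simp add: isLub_iff)
  define p n where "p = sup s 0" and "n = sup (- s) 0"
  have pn: "inf p n = 0" unfolding p_def n_def by (rule inf_pos_neg_part)
  define z where "z = inf p x"
  have z0: "0 \<le> z" using x by (simp add: z_def p_def)
  \<comment> \<open>Removing z from p leaves an upper bound of D: the positive part of d is disjoint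
    from z, so their sum is their supremum, which is at most p. Hence z \<le> p - s = n, while z
    \<le> p, and p and n are disjoint.\<close>
  have "d \<le> p - z" if d: "d \<in> D" for d
  proof -
    have "inf (sup d 0) z = 0"
    proof -
      have "inf \<bar>d\<bar> x = 0" using Ds d by blast
      then have "inf (sup d 0) x = 0"
        by (rule disjoint_mono) (simp_all add: abs_ge_self)
      then have "inf (sup d 0) z \<le> 0"
        using inf_mono[of "sup d 0" "sup d 0" z x] by (simp add: z_def)
      then show ?thesis using z0 by (intro antisym) simp_all
    qed
    then have "sup d 0 + z = sup (sup d 0) z"
      using add_eq_inf_sup[of "sup d 0" z] by simp
    also have "\<dots> \<le> p"
      using ub[OF d] by (simp add: le_supI1 le_infI1 z_def p_def)
    finally have "sup d 0 \<le> p - z" by (simp add: le_diff_eq)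
    then show ?thesis using sup_ge1 order_trans by blast
  qed
  then have "s \<le> p - z" using Ds by (simp add: isLub_iff)
  then have "z \<le> p - s" by (simp add: algebra_simps)
  also have "p - s = n" using add_sup_distrib_right[of s 0 "- s"] by (simp add: sup.commute p_def n_def)
  finally have "z \<le> inf p n" by (simp add: z_def)
  then have "z = 0" using pn z0 by (simp add: antisym)
  then have p: "p \<in> ?B" by (simp add: z_def p_def)
  \<comment> \<open>Any single element d0 of D controls the negative part, because d0 \<le>
    s.\<close>
  have n: "n \<in> ?B"
  proof -
    have "\<bar>n\<bar> \<le> \<bar>d0\<bar>"
    proof -
      have "- s \<le> - d0" using ub[OF d0] by simp
      also have "\<dots> \<le> \<bar>d0\<bar>" by (rule abs_ge_minus_self)
      finally show ?thesis by (simp add: n_def)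
    qed
    then show ?thesis using ideal Ds d0 unfolding order_ideal_def by blast
  qed
  have "s = p - n" using \<open>p - s = n\<close> by (simp add: algebra_simps)
  moreover have "subspace ?B" using ideal by (simp add: order_ideal_def)
  ultimately show "s \<in> ?B" using subspace_diff[OF _ p n] by simp
qed

text \<open>Since -p \<le> q, the element -p lies below both |p| and |q|. It makes both band
  components of a positive element positive.\<close>

lemma disjoint_summand_nonneg:
  fixes p q :: "'a::archimedean_vector_lattice"
  assumes "inf \<bar>p\<bar> \<bar>q\<bar> = 0" and "0 \<le> p + q"
  shows "0 \<le> p"
proof -
  have "- p \<le> q" using assms(2) by (subst add_le_cancel_left[of p, symmetric]) simp
  then have "- p \<le> \<bar>q\<bar>" using abs_ge_self order_trans by blast
  then have "- p \<le> inf \<bar>p\<bar> \<bar>q\<bar>" using abs_ge_minus_self by simp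
  then show ?thesis using assms(1) by simp
qed


subsection \<open>Countable suprema in the order completion\<close>

context
  fixes \<iota> :: "'a::archimedean_vector_lattice \<Rightarrow>
    'b::{archimedean_vector_lattice, conditionally_complete_lattice}"
  assumes compl: "is_order_completion \<iota>"
begin

section \<open>The embedding into the order completion\<close>

lemma linear_embedding: "linear \<iota>"
  using compl unfolding is_order_completion_def by blast

lemmas embedding_linear_simps =
  linear_add[OF linear_embedding] linear_diff[OF linear_embedding]
  linear_scale[OF linear_embedding] linear_0[OF linear_embedding]

lemma embedding_sup: "\<iota> (sup x y) = sup (\<iota> x) (\<iota> y)"
  and embedding_inf: "\<iota> (inf x y) = inf (\<iota> x) (\<iota> y)"
  and embedding_eq_iff: "\<iota> x = \<iota> y \<longleftrightarrow> x = y"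
  using compl unfolding is_order_completion_def inj_def by blast+

lemma embedding_le_iff: "\<iota> x \<le> \<iota> y \<longleftrightarrow> x \<le> y"
  unfolding le_iff_sup embedding_sup[symmetric] by (rule embedding_eq_iff)

lemma embedding_nonneg_iff: "0 \<le> \<iota> x \<longleftrightarrow> 0 \<le> x"
  using embedding_le_iff[of 0 x] by (simp add: embedding_linear_simps)

lemma order_dense:
  assumes "0 < y"
  shows "\<exists>x>0. \<iota> x \<le> y"
proof -
  obtain x where x: "0 < \<iota> x" "\<iota> x \<le> y"
    using compl assms unfolding is_order_completion_def by blast
  then have "0 < x"
    using embedding_nonneg_iff[of x] by (auto simp: less_le embedding_linear_simps)
  then show ?thesis using x(2) by blast
qed

lemma majorizing: "\<exists>x. y \<le> \<iota> x"
  using compl unfolding is_order_completion_def by blast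

lemma vector_sublattice_range: "vector_sublattice (range \<iota>)"
  unfolding vector_sublattice_def
proof (intro conjI ballI)
  show "subspace (range \<iota>)" by (rule linear_subspace_image[OF linear_embedding subspace_UNIV])
  fix x y assume "x \<in> range \<iota>" "y \<in> range \<iota>"
  then obtain a b where "x = \<iota> a" "y = \<iota> b" by blast
  then show "sup x y \<in> range \<iota>" "inf x y \<in> range \<iota>"
    by (simp_all only: embedding_sup[symmetric] embedding_inf[symmetric] rangeI)
qed

text \<open>A regulator may be enlarged, and the range majorizes. With a regulator from X, shifts by
  its multiples stay inside sets that are stable under translation by X.\<close>

lemma mem_uniform_adherence_regulator:
  assumes "y \<in> uniform_adherence A"
  obtains e where "0 \<le> e" "\<And>\<epsilon>::real. \<epsilon> > 0 \<Longrightarrow> \<exists>z\<in>A. \<bar>z - y\<bar> \<le> \<epsilon> *\<^sub>R \<iota> e"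
proof -
  obtain e where e: "e \<ge> 0" "\<And>\<epsilon>::real. \<epsilon> > 0 \<Longrightarrow> \<exists>z\<in>A. \<bar>z - y\<bar> \<le> \<epsilon> *\<^sub>R e"
    using assms unfolding mem_uniform_adherence_iff by blast
  obtain x where x: "e \<le> \<iota> x" using majorizing by blast
  have "0 \<le> x" using order_trans[OF e(1) x] by (simp add: embedding_nonneg_iff)
  moreover have "\<exists>z\<in>A. \<bar>z - y\<bar> \<le> \<epsilon> *\<^sub>R \<iota> x" if "\<epsilon> > 0" for \<epsilon> :: real
    using e(2)[OF that] scaleR_left_mono[OF x, of \<epsilon>] that order_trans by fastforce
  ultimately show ?thesis using that by blast
qed

section \<open>Countable suprema and uniform limits\<close>

definition countable_sups :: "'b set" where
  "countable_sups = {y. \<exists>C. countable C \<and> isLub UNIV (\<iota> ` C) y}"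

lemma range_subset_countable_sups: "range \<iota> \<subseteq> countable_sups"
proof
  fix y assume "y \<in> range \<iota>"
  then obtain x where "y = \<iota> x" by blast
  then show "y \<in> countable_sups"
    unfolding countable_sups_def by (auto simp: isLub_iff intro!: exI[of _ "{x}"])
qed

text \<open>Only translations by X are treated. Stability under negation is not visible from suprema
  and comes later, from the equality with the adherence.\<close>

lemma countable_sups_diff:
  assumes "y \<in> countable_sups"
  shows "y - \<iota> x \<in> countable_sups"
proof -
  obtain C where C: "countable C" "isLub UNIV (\<iota> ` C) y"
    using assms by (auto simp: countable_sups_def)
  have "(\<lambda>c. c - \<iota> x) ` \<iota> ` C = \<iota> ` (\<lambda>c. c - x) ` C"
    by (simp add: image_image embedding_linear_simps)
  then show ?thesis
    unfolding countable_sups_def using C(1) isLub_translate[OF C(2), of "\<iota> x"]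
    by (intro CollectI exI[of _ "(\<lambda>c. c - x) ` C"]) simp
qed

lemma countable_sups_Lub:
  assumes S: "S \<subseteq> countable_sups" "countable S" and y: "isLub UNIV S y"
  shows "y \<in> countable_sups"
proof -
  have "\<forall>s\<in>S. \<exists>C. countable C \<and> isLub UNIV (\<iota> ` C) s"
    using S(1) unfolding countable_sups_def by blast
  then obtain C where C: "\<forall>s\<in>S. countable (C s) \<and> isLub UNIV (\<iota> ` C s) s"
    by (rule bchoice[THEN exE])
  have "isLub UNIV (\<iota> ` (\<Union>s\<in>S. C s)) y"
    unfolding image_UN by (rule isLub_UNION[OF y]) (use C in blast)
  moreover have "countable (\<Union>s\<in>S. C s)" using S(2) C by blast
  ultimately show ?thesis unfolding countable_sups_def by blast
qed

text \<open>Take \<open>z\<^sub>n \<in> A\<close> with \<open>\<bar>z\<^sub>n - y\<bar> \<le> e/n\<close> and let \<open>S\<close> consist of the elements \<open>z\<^sub>n - e/n\<close>. Since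
  the upper bounds \<open>z\<^sub>n + e/n\<close> belong to \<open>A\<close> as well, the supremum of \<open>S\<close> does not depend on the
  set \<open>Z \<supseteq> A\<close> in which it is taken.\<close>

lemma uniform_adherence_countable_Lub:
  assumes A: "\<forall>z\<in>A. \<forall>x. z - \<iota> x \<in> A" and y: "y \<in> uniform_adherence A"
  obtains S where "S \<subseteq> A" "countable S" "S \<noteq> {}"
    "\<And>Z. A \<subseteq> Z \<Longrightarrow> (\<exists>u. isUb Z S u)"
    "\<And>Z s. A \<subseteq> Z \<Longrightarrow> isLub Z S s \<Longrightarrow> s = y"
    "isLub UNIV S y"
proof -
  obtain e where e: "0 \<le> e" "\<And>\<epsilon>::real. \<epsilon> > 0 \<Longrightarrow> \<exists>z\<in>A. \<bar>z - y\<bar> \<le> \<epsilon> *\<^sub>R \<iota> e"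
    using mem_uniform_adherence_regulator[OF y] by blast
  let ?d = "\<lambda>n. 1 / real (Suc n)"
  have "\<exists>z\<in>A. \<bar>z - y\<bar> \<le> ?d n *\<^sub>R \<iota> e" for n by (intro e(2)) simp
  then obtain z where z: "\<And>n. z n \<in> A" "\<And>n. \<bar>z n - y\<bar> \<le> ?d n *\<^sub>R \<iota> e" by metis
  define l where "l n = z n - ?d n *\<^sub>R \<iota> e" for n
  define u where "u n = z n + ?d n *\<^sub>R \<iota> e" for n
  have lA: "l n \<in> A" for n
    using A[rule_format, OF z(1)[of n], of "?d n *\<^sub>R e"] by (simp add: l_def embedding_linear_simps)
  have uA: "u n \<in> A" for n
    using A[rule_format, OF z(1)[of n], of "(- ?d n) *\<^sub>R e"] by (simp only: u_def embedding_linear_simps) simp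
  have ly: "l n \<le> y" for n
    using abs_le_D1[OF z(2)[of n]] by (simp add: l_def algebra_simps)
  have yu: "y \<le> u n" for n
    using abs_le_D2[OF z(2)[of n]] by (simp add: u_def algebra_simps)
  have e0: "0 \<le> 2 *\<^sub>R \<iota> e" using e(1) by (simp add: scaleR_nonneg_nonneg embedding_nonneg_iff)
  \<comment> \<open>The gap u n - l n is 2e/(n+1), so by the Archimedean property whatever lies
    below all u n lies below whatever is above all l n.\<close>
  have squeeze: "a \<le> b" if au: "\<And>n. a \<le> u n" and lb: "\<And>n. l n \<le> b" for a b
  proof -
    have "a - b \<le> \<epsilon> *\<^sub>R (2 *\<^sub>R \<iota> e)" if \<epsilon>: "\<epsilon> > 0" for \<epsilon> :: real
    proof -
      obtain n where n: "?d n < \<epsilon>" using nat_approx_posE[OF \<epsilon>] by blast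
      have "a - b \<le> u n - l n" by (rule diff_mono[OF au lb])
      also have "\<dots> = ?d n *\<^sub>R (2 *\<^sub>R \<iota> e)"
        by (simp add: u_def l_def scaleR_2 scaleR_add_right)
      also have "\<dots> \<le> \<epsilon> *\<^sub>R (2 *\<^sub>R \<iota> e)" using n e0 by (intro scaleR_right_mono) auto
      finally show ?thesis .
    qed
    then have "a - b \<le> 0" by (rule le_zero_if_le_scaleR[OF e0])
    then show ?thesis by simp
  qed
  have lu: "l m \<le> u n" for m n using ly yu order_trans by blast
  show ?thesis
  proof (rule that[of "range l"])
    show "range l \<subseteq> A" "countable (range l)" "range l \<noteq> {}" using lA by auto
    show "\<exists>b. isUb Z (range l) b" if "A \<subseteq> Z" for Z
      using that uA[of 0] lu[of _ 0] by (intro exI[of _ "u 0"]) (auto simp: isUb_def setle_def)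
    show "isLub UNIV (range l) y" using ly squeeze[OF yu] by (simp add: isLub_iff)
    show "s = y" if Z: "A \<subseteq> Z" "isLub Z (range l) s" for Z s
    proof -
      have "l n \<le> s" for n using Z(2) by (simp add: isLub_iff)
      moreover have "s \<le> u n" for n
      proof -
        have "u n \<in> Z" "\<forall>a\<in>range l. a \<le> u n" using Z(1) uA lu by auto
        then show ?thesis using Z(2) unfolding isLub_iff by blast
      qed
      ultimately show ?thesis
        using squeeze[of s y, OF _ ly] squeeze[of y s, OF yu] by (simp add: antisym)
    qed
  qed
qed

lemma uniform_adherence_countable_sups: "uniform_adherence countable_sups \<subseteq> countable_sups"
proof
  fix y assume y: "y \<in> uniform_adherence countable_sups"
  have diff: "\<forall>z\<in>countable_sups. \<forall>x. z - \<iota> x \<in> countable_sups"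
    by (intro ballI allI countable_sups_diff)
  obtain S where "S \<subseteq> countable_sups" "countable S" "isLub UNIV S y"
    by (rule uniform_adherence_countable_Lub[OF diff y]) (rule that)
  then show "y \<in> countable_sups" by (rule countable_sups_Lub)
qed

section \<open>Approximation of countable suprema by elements of X\<close>

text \<open>That \<open>p - v \<le> y\<close> amounts to the disjointness of \<open>p\<close> from the negative part of \<open>y\<close>. It can be
  tested on elements of \<open>X\<close> by order density, which keeps all bands inside \<open>X\<close>.\<close>

lemma halving:
  assumes proj: "sigma_projection_property TYPE('a)"
    and y: "y \<in> countable_sups" and yv: "\<bar>y\<bar> \<le> \<iota> v"
  obtains x where "\<bar>y - \<iota> x\<bar> \<le> \<iota> ((1/2) *\<^sub>R v)"
proof -
  obtain C where C: "countable C" "isLub UNIV (\<iota> ` C) y"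
    using y by (auto simp: countable_sups_def)
  have v0: "0 \<le> v" using order_trans[OF abs_ge_zero yv] by (simp add: embedding_nonneg_iff)
  define P where "P = (\<lambda>c. sup c 0) ` C"
  have "projection_band (band hull P)"
    using proj C(1) by (simp add: sigma_projection_property_def P_def)
  then obtain p q where p: "p \<in> band hull P" and q: "q \<in> disjoint_complement (band hull P)"
    and v: "v = p + q"
    unfolding projection_band_def by blast
  have qp: "inf \<bar>q\<bar> \<bar>p\<bar> = 0" using p q unfolding disjoint_complement_def by blast
  then have pq: "inf \<bar>p\<bar> \<bar>q\<bar> = 0" by (subst inf.commute)
  have p0: "0 \<le> p" by (rule disjoint_summand_nonneg[OF pq]) (use v0 v in simp)
  have q0: "0 \<le> q" by (rule disjoint_summand_nonneg[OF qp]) (use v0 v in \<open>simp add: add.commute\<close>)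
  have cy: "\<iota> c \<le> y" if "c \<in> C" for c using C(2) that by (simp add: isLub_iff)
  \<comment> \<open>The positive part of c is at most v = p + q, so its excess over p is below both
    q and that positive part. These are disjoint, since the latter lies in the band.\<close>
  have "c \<le> p" if c: "c \<in> C" for c
  proof -
    have "\<iota> c \<le> \<iota> v" using cy[OF c] yv abs_ge_self[of y] by (meson order_trans)
    then have "sup c 0 \<le> v" using v0 by (simp add: embedding_le_iff)
    then have "sup c 0 - p \<le> q" by (simp add: v diff_le_eq add.commute)
    moreover have "sup c 0 - p \<le> sup c 0" using p0 by simp
    ultimately have "sup c 0 - p \<le> inf q (sup c 0)" by simp
    moreover have "sup c 0 \<in> band hull P"
      by (rule hull_inc) (use c in \<open>simp add: P_def\<close>)
    then have "inf \<bar>q\<bar> \<bar>sup c 0\<bar> = 0"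
      using q unfolding disjoint_complement_def by blast
    then have "inf q (sup c 0) = 0" using q0 by simp
    ultimately have "sup c 0 - p \<le> 0" by metis
    then show ?thesis by simp
  qed
  then have upper: "y \<le> \<iota> p" using C(2) by (auto simp: isLub_iff embedding_le_iff)
  let ?n = "sup (- y) 0"
  have disj: "inf ?n (\<iota> p) = 0"
  proof (rule ccontr)
    assume "inf ?n (\<iota> p) \<noteq> 0"
    then have "0 < inf ?n (\<iota> p)" using p0 by (simp add: less_le embedding_nonneg_iff)
    then obtain w where w: "w > 0" "\<iota> w \<le> inf ?n (\<iota> p)" using order_dense by blast
    \<comment> \<open>As w is below the negative part of y, it is disjoint from the positive part of
      y and so from P. By minimality of the hull it is disjoint from p, contradicting 0 < w \<le>
      p.\<close>
    have "P \<subseteq> {a. inf \<bar>a\<bar> w = 0}"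
    proof
      fix a assume "a \<in> P"
      then obtain c where c: "c \<in> C" "a = sup c 0" by (auto simp: P_def)
      have "inf (sup y 0) ?n = 0" by (rule inf_pos_neg_part)
      moreover have "\<iota> (sup c 0) \<le> sup y 0"
        using cy[OF c(1)] by (simp add: embedding_sup embedding_linear_simps le_supI1)
      ultimately have "\<iota> (inf (sup c 0) w) \<le> 0"
        using w(2) inf_mono[of "\<iota> (sup c 0)" "sup y 0" "\<iota> w" ?n] by (simp add: embedding_inf)
      then have "inf (sup c 0) w \<le> 0"
        using embedding_le_iff[of _ 0] by (simp add: embedding_linear_simps)
      then show "a \<in> {a. inf \<bar>a\<bar> w = 0}" using c w(1) by (simp add: antisym)
    qed
    then have "band hull P \<subseteq> {a. inf \<bar>a\<bar> w = 0}"
      using band_disjoint[of w] w(1) by (intro hull_minimal) auto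
    then have "inf p w = 0" using p p0 by auto
    moreover have "w \<le> p" using w(2) by (simp add: embedding_le_iff)
    ultimately show False using w(1) by (simp add: inf_absorb2)
  qed
  \<comment> \<open>The negative part of y is at most v = p + q, so its excess over q lies below
    both p and that negative part, which are disjoint.\<close>
  have "?n \<le> \<iota> p + \<iota> q"
    using abs_le_D2[OF yv] v0
    by (simp add: linear_add[OF linear_embedding, symmetric] embedding_nonneg_iff v)
  then have "?n - \<iota> q \<le> \<iota> p" by (simp add: diff_le_eq)
  moreover have "?n - \<iota> q \<le> ?n" using q0 by (simp add: embedding_nonneg_iff)
  ultimately have "?n - \<iota> q \<le> 0" using disj by (metis le_inf_iff)
  then have lower: "- y \<le> \<iota> q" by simp
  \<comment> \<open>The interval from -q to p contains y, has length v and midpoint p - v/2.\<close>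
  define h where "h = \<iota> ((1/2) *\<^sub>R v)"
  have "h + h = \<iota> p + \<iota> q"
    by (simp add: h_def v linear_add[OF linear_embedding, symmetric] flip: scaleR_add_left)
  then have ph: "\<iota> p - h = h - \<iota> q" by (simp add: algebra_simps)
  have x: "\<iota> (p - (1/2) *\<^sub>R v) = \<iota> p - h"
    by (simp add: h_def linear_diff[OF linear_embedding])
  have "y - (\<iota> p - h) \<le> h" using upper by (simp add: algebra_simps)
  moreover have "- (y - (\<iota> p - h)) \<le> h"
    unfolding ph using add_right_mono[OF lower, of "h - \<iota> q"] by simp
  ultimately have "\<bar>y - \<iota> (p - (1/2) *\<^sub>R v)\<bar> \<le> \<iota> ((1/2) *\<^sub>R v)"
    unfolding x h_def[symmetric] by (rule abs_leI)
  then show ?thesis by (rule that)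
qed

lemma countable_sups_subset_uniform_adherence:
  assumes proj: "sigma_projection_property TYPE('a)"
  shows "countable_sups \<subseteq> uniform_adherence (range \<iota>)"
proof
  fix y assume y: "y \<in> countable_sups"
  obtain v where v: "\<bar>y\<bar> \<le> \<iota> v" using majorizing by blast
  have v0: "0 \<le> \<iota> v" using order_trans[OF abs_ge_zero v] .
  \<comment> \<open>The remainder y - \<iota> x stays in \<open>countable_sups\<close>, so
    \<open>halving\<close> applies to it with v/2^n in place of v; the corrections add up.\<close>
  have approx: "\<exists>x. \<bar>y - \<iota> x\<bar> \<le> \<iota> ((1/2)^n *\<^sub>R v)" for n
  proof (induction n)
    case 0
    show ?case using v by (intro exI[of _ 0]) (simp add: embedding_linear_simps)
  next
    case (Suc n)
    then obtain x where x: "\<bar>y - \<iota> x\<bar> \<le> \<iota> ((1/2)^n *\<^sub>R v)" by blast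
    obtain x' where "\<bar>(y - \<iota> x) - \<iota> x'\<bar> \<le> \<iota> ((1/2) *\<^sub>R ((1/2)^n *\<^sub>R v))"
      using halving[OF proj countable_sups_diff[OF y] x] by blast
    then show ?case
      by (intro exI[of _ "x + x'"]) (simp add: embedding_linear_simps diff_diff_add)
  qed
  have "\<exists>z\<in>range \<iota>. \<bar>z - y\<bar> \<le> \<epsilon> *\<^sub>R \<iota> v" if \<epsilon>: "\<epsilon> > 0" for \<epsilon> :: real
  proof -
    obtain n where n: "(1/2::real)^n < \<epsilon>" using real_arch_pow_inv[OF \<epsilon>, of "1/2"] by auto
    obtain x where "\<bar>y - \<iota> x\<bar> \<le> \<iota> ((1/2)^n *\<^sub>R v)" using approx by blast
    also have "\<dots> = (1/2)^n *\<^sub>R \<iota> v" by (rule embedding_linear_simps)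
    also have "\<dots> \<le> \<epsilon> *\<^sub>R \<iota> v" using n v0 by (intro scaleR_right_mono) auto
    finally show ?thesis by (auto simp: abs_minus_commute)
  qed
  then show "y \<in> uniform_adherence (range \<iota>)"
    unfolding mem_uniform_adherence_iff using v0 by blast
qed

section \<open>Identification of the adherence, completeness and minimality\<close>

lemma uniform_adherence_range_eq:
  assumes "sigma_projection_property TYPE('a)"
  shows "uniform_adherence (range \<iota>) = countable_sups"
proof
  show "uniform_adherence (range \<iota>) \<subseteq> countable_sups"
    using uniform_adherence_mono[OF range_subset_countable_sups] uniform_adherence_countable_sups
    by (rule order_trans)
  show "countable_sups \<subseteq> uniform_adherence (range \<iota>)"
    by (rule countable_sups_subset_uniform_adherence[OF assms])
qed

text \<open>The supremum in the Dedekind complete lattice already belongs to the set, so it is also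
  the supremum relative to the set.\<close>

lemma countably_order_complete_countable_sups: "countably_order_complete countable_sups"
  unfolding countably_order_complete_def
proof (intro allI impI, elim conjE exE)
  fix S u assume S: "S \<subseteq> countable_sups" "countable S" "S \<noteq> {}" and "isUb countable_sups S u"
  then have "bdd_above S" by (auto simp: isUb_def setle_def bdd_above_def)
  then have lub: "isLub UNIV S (Sup S)"
    using S(3) by (auto simp: isLub_iff intro: cSup_upper cSup_least)
  then have "isLub countable_sups S (Sup S)"
    using countable_sups_Lub[OF S(1,2) lub] by (simp add: isLub_iff)
  then show "\<exists>s. isLub countable_sups S s" ..
qed

text \<open>In general a supremum in \<open>Z\<close> may exceed the one in the completion. The sets
  from \<open>uniform_adherence_countable_Lub\<close> are squeezed by elements of X, which forces
  the two to agree.\<close>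

lemma uniform_adherence_range_least:
  assumes Z: "countably_order_complete Z" "range \<iota> \<subseteq> Z"
  shows "uniform_adherence (range \<iota>) \<subseteq> Z"
proof
  fix y assume y: "y \<in> uniform_adherence (range \<iota>)"
  have diff: "\<forall>z\<in>range \<iota>. \<forall>x. z - \<iota> x \<in> range \<iota>"
    by (auto simp: linear_diff[OF linear_embedding, symmetric])
  obtain S where S: "S \<subseteq> range \<iota>" "countable S" "S \<noteq> {}"
    and ub: "\<And>Z. range \<iota> \<subseteq> Z \<Longrightarrow> \<exists>u. isUb Z S u"
    and eq: "\<And>Z s. range \<iota> \<subseteq> Z \<Longrightarrow> isLub Z S s \<Longrightarrow> s = y"
    by (rule uniform_adherence_countable_Lub[OF diff y]) (rule that)
  have "S \<subseteq> Z" using S(1) Z(2) by (rule order_trans)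
  then obtain s where s: "isLub Z S s"
    using Z(1) S(2,3) ub[OF Z(2)] unfolding countably_order_complete_def by blast
  then show "y \<in> Z" using eq[OF Z(2) s] by (simp add: isLub_iff)
qed

end

theorem theorem8p10:
  fixes \<iota> :: "'a::archimedean_vector_lattice \<Rightarrow>
    'b::{archimedean_vector_lattice, conditionally_complete_lattice}"
  assumes "sigma_projection_property TYPE('a)"
    and "is_order_completion \<iota>"
  shows "uniform_adherence (range \<iota>) = uniform_closure (range \<iota>) \<and>
    (vector_sublattice (uniform_closure (range \<iota>)) \<and>
     countably_order_complete (uniform_closure (range \<iota>)) \<and>
     range \<iota> \<subseteq> uniform_closure (range \<iota>) \<and>
     (\<forall>Z. vector_sublattice Z \<and> countably_order_complete Z \<and> range \<iota> \<subseteq> Z \<longrightarrow>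
        uniform_closure (range \<iota>) \<subseteq> Z))"
proof -
  note eq = uniform_adherence_range_eq[OF assms(2,1)]
  \<comment> \<open>Once the adherence is known to be \<open>countable_sups\<close>, its idempotence
    is the stability of \<open>countable_sups\<close> under uniform limits.\<close>
  have clos: "uniform_closure (range \<iota>) = uniform_adherence (range \<iota>)"
    by (rule uniform_closure_eq_adherence)
      (simp add: eq uniform_adherence_countable_sups[OF assms(2)])
  show ?thesis
    unfolding clos
    using vector_sublattice_uniform_adherence[OF vector_sublattice_range[OF assms(2)]]
      countably_order_complete_countable_sups[OF assms(2)]
      uniform_adherence_range_least[OF assms(2)]
      range_subset_countable_sups[OF assms(2)]
    by (simp add: eq)
qed

end
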